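(* Let $\mathbb{G}$ be a non-compliant graph. Then $\mathbb{H}=\mathbb{G}\circ \mathbb{K}_n$ is a compliant graph and $_{\mathbb{H}}d_{td}(a_i,b_j)\leq 2\, {_{\mathbb{G}}d_{d}}(a_i).$
   Context: $\mathbb{G}$ has vertices $a_1,\dots,a_m$ and $\mathbb{K}_n$ has vertices $b_1,\dots,b_n$ ($n\ge 2$). The composition $\mathbb{G}\circ\mathbb{K}_n$ has vertex set $V(\mathbb{G})\times V(\mathbb{K}_n)$, with $(a,b)$ adjacent to $(a',b')$ iff $a$ is adjacent to $a'$ in $\mathbb{G}$, or $a=a'$ and $b$ adjacent to $b'$ in $\mathbb{K}_n$. A total dominating set (TDS) is a vertex set $S$ such that every vertex is adjacent to a vertex of $S$; a minimal TDS (MTDS) has no proper subset that is a TDS. A vertex is compliant if some MTDS contains it; a graph is compliant if all its vertices are, and non-compliant otherwise. For a compliant graph $\mathbb{X}$, $_{\mathbb{X}}d_{td}(a)=\min\{|S| : S \text{ an MTDS of } \mathbb{X} \text{ containing } a\}$. The domination degree $_{\mathbb{G}}d_d(a)$ is the minimum cardinality of a minimal dominating set of $\mathbb{G}$ containing $a$. *)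

theory Defs
  imports "Graph_Theory.Graph_Theory"
begin

text \<open>
  Finite simple graphs are modelled by the locale \<^locale>\<open>pair_graph\<close>: finite, loop-free,
  symmetric digraphs whose arcs are pairs of vertices.  Two vertices \<open>u\<close>, \<open>v\<close> are adjacent
  iff \<open>(u, v) \<in> parcs G\<close>.
\<close>

definition composition :: "'a pair_pre_digraph \<Rightarrow> 'b pair_pre_digraph \<Rightarrow> ('a \<times> 'b) pair_pre_digraph"
    (infixl "\<circ>\<^sub>G" 70) where
  "G \<circ>\<^sub>G K = \<lparr> pverts = pverts G \<times> pverts K,
     parcs = {((a, b), (a', b')).
       (a, b) \<in> pverts G \<times> pverts K \<and> (a', b') \<in> pverts G \<times> pverts K \<and>
       ((a, a') \<in> parcs G \<or> a = a' \<and> (b, b') \<in> parcs K)} \<rparr>"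

lemma pair_graph_composition:
  assumes "pair_graph G" and "pair_graph K"
  shows "pair_graph (G \<circ>\<^sub>G K)"
proof -
  interpret G: pair_graph G by fact
  interpret K: pair_graph K by fact
  have fin: "finite (pverts (G \<circ>\<^sub>G K))"
    by (simp add: composition_def)
  have "parcs (G \<circ>\<^sub>G K) \<subseteq> pverts (G \<circ>\<^sub>G K) \<times> pverts (G \<circ>\<^sub>G K)"
    by (auto simp: composition_def)
  then have "finite (parcs (G \<circ>\<^sub>G K))"
    using fin by (meson finite_SigmaI finite_subset)
  moreover have "sym (parcs (G \<circ>\<^sub>G K))"
    using arcs_ends_symmetric[OF G.pair_sym_arcs] arcs_ends_symmetric[OF K.pair_sym_arcs]
    by (auto simp: composition_def intro!: symI)
  moreover have "fst e \<noteq> snd e" if "e \<in> parcs (G \<circ>\<^sub>G K)" for e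
    using that G.pair_no_loops K.pair_no_loops by (fastforce simp: composition_def)
  ultimately show ?thesis
    using fin by unfold_locales (auto simp: composition_def symmetric_def)
qed

definition dominating_set :: "'a pair_pre_digraph \<Rightarrow> 'a set \<Rightarrow> bool" where
  "dominating_set G S \<longleftrightarrow> S \<subseteq> pverts G \<and> (\<forall>v \<in> pverts G - S. \<exists>u \<in> S. (v, u) \<in> parcs G)"

definition minimal_dominating_set :: "'a pair_pre_digraph \<Rightarrow> 'a set \<Rightarrow> bool" where
  "minimal_dominating_set G S \<longleftrightarrow> dominating_set G S \<and> (\<forall>T. T \<subset> S \<longrightarrow> \<not> dominating_set G T)"

definition total_dominating_set :: "'a pair_pre_digraph \<Rightarrow> 'a set \<Rightarrow> bool" where
  "total_dominating_set G S \<longleftrightarrow> S \<subseteq> pverts G \<and> (\<forall>v \<in> pverts G. \<exists>u \<in> S. (v, u) \<in> parcs G)"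

definition minimal_total_dominating_set :: "'a pair_pre_digraph \<Rightarrow> 'a set \<Rightarrow> bool" where
  "minimal_total_dominating_set G S \<longleftrightarrow>
     total_dominating_set G S \<and> (\<forall>T. T \<subset> S \<longrightarrow> \<not> total_dominating_set G T)"

definition compliant_vertex :: "'a pair_pre_digraph \<Rightarrow> 'a \<Rightarrow> bool" where
  "compliant_vertex G a \<longleftrightarrow> (\<exists>S. minimal_total_dominating_set G S \<and> a \<in> S)"

definition compliant :: "'a pair_pre_digraph \<Rightarrow> bool" where
  "compliant G \<longleftrightarrow> (\<forall>a \<in> pverts G. compliant_vertex G a)"

text \<open>
  On \<^typ>\<open>nat\<close>, \<^const>\<open>Inf\<close> of a nonempty set is its least element.  The set below is nonempty
  for every vertex of a finite simple graph, since a vertex can be extended to a maximal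
  independent set.
\<close>

definition domination_degree :: "'a pair_pre_digraph \<Rightarrow> 'a \<Rightarrow> nat" where
  "domination_degree G a = Inf {card S | S. minimal_dominating_set G S \<and> a \<in> S}"

text \<open>
  Meaningful only for compliant vertices: otherwise the set is empty and the value is the
  conventional \<open>Inf {} = 0\<close>.
\<close>

definition total_domination_degree :: "'a pair_pre_digraph \<Rightarrow> 'a \<Rightarrow> nat" where
  "total_domination_degree G a = Inf {card S | S. minimal_total_dominating_set G S \<and> a \<in> S}"

end

theory Submission
  imports Defs
begin

text \<open>
  Let \<open>S\<close> be a minimal dominating set of \<open>G\<close> containing \<open>a\<close>, and let \<open>b' \<noteq> b\<close> in \<open>K\<^sub>n\<close>.  Take the
  copy \<open>S \<times> {b}\<close> and add \<open>(u, b')\<close> for every \<open>u \<in> S\<close> without a neighbour in \<open>S\<close>.  This is a total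
  dominating set of \<open>G \<circ> K\<^sub>n\<close> of size at most \<open>2|S|\<close>.  By minimality of \<open>S\<close>, either \<open>a\<close> has no
  neighbour in \<open>S\<close>, and then \<open>(a, b)\<close> is the only neighbour of \<open>(a, b')\<close> in the set; or \<open>a\<close> has a
  private neighbour \<open>w\<close> outside \<open>S\<close>, and then \<open>(a, b)\<close> is the only neighbour of \<open>(w, b)\<close> in it.
  So every total dominating subset, in particular a minimal one, still contains \<open>(a, b)\<close>.
\<close>

lemma parcs_sym:
  assumes "pair_graph G" and "(u, v) \<in> parcs G"
  shows "(v, u) \<in> parcs G"
proof -
  interpret pair_graph G by fact
  show ?thesis using arcs_ends_symmetric[OF pair_sym_arcs] assms(2) by (auto dest: symD)
qed

lemma minimal_total_dominating_subset:
  assumes "finite (pverts G)" and "total_dominating_set G X"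
  obtains M where "minimal_total_dominating_set G M" and "M \<subseteq> X"
proof -
  have "{T. total_dominating_set G T} \<subseteq> Pow (pverts G)"
    by (auto simp: total_dominating_set_def)
  then have "finite {T. total_dominating_set G T}"
    using assms(1) by (meson finite_Pow_iff finite_subset)
  from finite_has_minimal2[OF this, of X] assms(2)
  show thesis
    using that unfolding minimal_total_dominating_set_def by blast
qed

text \<open>Deleting \<open>a\<close> from \<open>S\<close> leaves some vertex \<open>v\<close>
  undominated: either \<open>v = a\<close>, or \<open>v\<close> lies outside \<open>S\<close>.
  Adjacency of \<open>w\<close> and \<open>a\<close> is not recorded, since later uses recover it
  from total domination.\<close>

lemma minimal_dominating_set_private:
  assumes "minimal_dominating_set G S" and "a \<in> S"
  obtains (isolated) "\<forall>u \<in> S - {a}. (a, u) \<notin> parcs G"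
  | (external) w where "w \<in> pverts G - S" and "\<forall>u \<in> S - {a}. (w, u) \<notin> parcs G"
proof -
  have "\<not> dominating_set G (S - {a})"
    using assms unfolding minimal_dominating_set_def by blast
  moreover have "S - {a} \<subseteq> pverts G"
    using assms unfolding minimal_dominating_set_def dominating_set_def by blast
  ultimately obtain v where "v \<in> pverts G - (S - {a})" "\<forall>u \<in> S - {a}. (v, u) \<notin> parcs G"
    unfolding dominating_set_def by blast
  then show thesis
    using isolated external by (cases "v = a") auto
qed

text \<open>A maximal independent set containing \<open>a\<close> works. A vertex it failed to
  dominate could be added to it, and a member left out of a smaller set has no neighbour there, by
  independence.\<close>

lemma ex_minimal_dominating_set:
  assumes "pair_graph G" and "a \<in> pverts G"
  obtains S where "minimal_dominating_set G S" and "a \<in> S"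
proof -
  interpret pair_graph G by fact
  let ?indep = "{I. I \<subseteq> pverts G \<and> a \<in> I \<and> (\<forall>u \<in> I. \<forall>v \<in> I. (u, v) \<notin> parcs G)}"
  have "?indep \<subseteq> Pow (pverts G)"
    by auto
  then have "finite ?indep"
    by (meson finite_Pow_iff finite_subset pair_finite_verts)
  moreover have loop: "(u, u) \<notin> parcs G" for u
    using pair_no_loops by fastforce
  then have "{a} \<in> ?indep"
    using assms(2) by auto
  ultimately have "\<exists>S \<in> ?indep. {a} \<subseteq> S \<and> (\<forall>T \<in> ?indep. S \<subseteq> T \<longrightarrow> S = T)"
    by (rule finite_has_maximal2)
  then obtain S where S: "S \<in> ?indep" and max: "\<forall>T \<in> ?indep. S \<subseteq> T \<longrightarrow> S = T"
    by (elim bexE conjE) (rule that)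
  have "\<exists>u \<in> S. (v, u) \<in> parcs G" if "v \<in> pverts G - S" for v
  proof (rule ccontr)
    assume "\<not> ?thesis"
    then have "insert v S \<in> ?indep"
      using S that loop parcs_sym[OF assms(1)] by auto
    then show False
      using bspec[OF max, of "insert v S"] that by blast
  qed
  then have "dominating_set G S"
    using S unfolding dominating_set_def by blast
  moreover have "\<not> dominating_set G T" if "T \<subset> S" for T
    using S that unfolding dominating_set_def by blast
  ultimately have "minimal_dominating_set G S"
    unfolding minimal_dominating_set_def by blast
  with S that show thesis by blast
qed

text \<open>\<open>S\<close> is left arbitrary: any choice gives compliance, and one of least size
  gives the bound on the degree.\<close>

lemma minimal_total_dominating_set_composition:
  assumes G: "pair_graph G"
    and K: "finite (pverts K)" "parcs K = {(u, v). u \<in> pverts K \<and> v \<in> pverts K \<and> u \<noteq> v}"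
    and b: "b \<in> pverts K" "b' \<in> pverts K" "b \<noteq> b'"
    and S: "minimal_dominating_set G S" "a \<in> S"
  obtains M where "minimal_total_dominating_set (G \<circ>\<^sub>G K) M" and "(a, b) \<in> M"
    and "card M \<le> 2 * card S"
proof -
  interpret pair_graph G by fact
  let ?X = "S \<times> {b} \<union> {u \<in> S. \<forall>v \<in> S. (u, v) \<notin> parcs G} \<times> {b'}"
  have SG: "S \<subseteq> pverts G" and dom: "\<And>v. v \<in> pverts G - S \<Longrightarrow> \<exists>u \<in> S. (v, u) \<in> parcs G"
    using S(1) unfolding minimal_dominating_set_def dominating_set_def by auto
  have "finite S"
    using SG finite_subset pair_finite_verts by blast
  have "\<exists>p \<in> ?X. ((v, c), p) \<in> parcs (G \<circ>\<^sub>G K)" if "v \<in> pverts G" "c \<in> pverts K" for v c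
  proof (cases "\<exists>u \<in> S. (v, u) \<in> parcs G")
    case True
    then obtain u where "u \<in> S" "(v, u) \<in> parcs G" by blast
    then have "((v, c), (u, b)) \<in> parcs (G \<circ>\<^sub>G K)"
      using that b SG by (auto simp: composition_def)
    with \<open>u \<in> S\<close> show ?thesis by blast
  next
    case False
    then have "v \<in> S"
      using dom that by blast
    \<comment> \<open>Here \<open>v\<close> has no neighbour in \<open>S\<close>, so both
      \<open>(v, b)\<close> and \<open>(v, b')\<close> were put into the set; the one whose second
      coordinate differs from \<open>c\<close> is adjacent to \<open>(v, c)\<close>.\<close>
    with False have "(v, if c = b then b' else b) \<in> ?X" by auto
    moreover have "((v, c), (v, if c = b then b' else b)) \<in> parcs (G \<circ>\<^sub>G K)"
      using that b K(2) by (auto simp: composition_def)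
    ultimately show ?thesis by (rule bexI[rotated])
  qed
  moreover have "?X \<subseteq> pverts (G \<circ>\<^sub>G K)"
    using SG b by (auto simp: composition_def)
  ultimately have "total_dominating_set (G \<circ>\<^sub>G K) ?X"
    unfolding total_dominating_set_def by (auto simp: composition_def)
  moreover have "finite (pverts (G \<circ>\<^sub>G K))"
    using K(1) by (simp add: composition_def)
  ultimately obtain M where M: "minimal_total_dominating_set (G \<circ>\<^sub>G K) M" "M \<subseteq> ?X"
    using minimal_total_dominating_subset by blast
  have nbr: "\<exists>p \<in> M. (q, p) \<in> parcs (G \<circ>\<^sub>G K)" if "q \<in> pverts G \<times> pverts K" for q
    using M(1) that
    by (auto simp: minimal_total_dominating_set_def total_dominating_set_def composition_def)
  have loop: "(u, u) \<notin> parcs G" for u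
    using pair_no_loops by fastforce
  \<comment> \<open>Separated out because the external case below falls back on it.\<close>
  have isolated_mem: "(a, b) \<in> M" if isol: "\<forall>u \<in> S. (a, u) \<notin> parcs G"
  proof -
    obtain p where p: "p \<in> M" "((a, b'), p) \<in> parcs (G \<circ>\<^sub>G K)"
      using nbr[of "(a, b')"] S(2) SG b by blast
    then have "fst p = a" "snd p \<noteq> b'"
      using M(2) isol K(2) by (auto simp: composition_def)
    with p M(2) have "p = (a, b)" by auto
    with p show ?thesis by simp
  qed
  have "(a, b) \<in> M"
    using S
  proof (cases rule: minimal_dominating_set_private)
    case isolated
    then have "\<forall>u \<in> S. (a, u) \<notin> parcs G"
      using loop by blast
    then show ?thesis by (rule isolated_mem)
  next
    case (external w)
    obtain p where p: "p \<in> M" "((w, b), p) \<in> parcs (G \<circ>\<^sub>G K)"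
      using nbr[of "(w, b)"] external(1) b by blast
    \<comment> \<open>As \<open>fst p\<close> is in \<open>S\<close> and \<open>w\<close> is not,
      the arc to \<open>p\<close> comes from an arc of \<open>G\<close>, and \<open>w\<close> has no
      neighbour in \<open>S\<close> other than \<open>a\<close>.\<close>
    then have "fst p = a"
      using M(2) external by (auto simp: composition_def)
    show ?thesis
    proof (cases "snd p = b")
      case True
      with p \<open>fst p = a\<close> show ?thesis by (metis prod.collapse)
    next
      \<comment> \<open>Now \<open>p = (a, b')\<close>, and this pair was added only if
        \<open>a\<close> has no neighbour in \<open>S\<close>.\<close>
      case False
      with p \<open>fst p = a\<close> M(2) have "\<forall>u \<in> S. (a, u) \<notin> parcs G" by auto
      then show ?thesis by (rule isolated_mem)
    qed
  qed
  moreover have "card M \<le> 2 * card S"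
  proof -
    have "M \<subseteq> S \<times> {b, b'}"
      using M(2) by auto
    then have "card M \<le> card (S \<times> {b, b'})"
      using \<open>finite S\<close> by (intro card_mono) auto
    also have "\<dots> = 2 * card S"
      using b(3) by (simp add: card_cartesian_product)
    finally show ?thesis .
  qed
  ultimately show thesis
    using that M(1) by blast
qed

theorem theorem9:
  fixes G :: "'a pair_pre_digraph" and K :: "'b pair_pre_digraph" and n :: nat
  assumes "pair_graph G"
    and "\<not> compliant G"
    and "n \<ge> 2"
    and "complete_digraph n (with_proj K)"
  shows "compliant (G \<circ>\<^sub>G K) \<and>
    (\<forall>a \<in> pverts G. \<forall>b \<in> pverts K.
       total_domination_degree (G \<circ>\<^sub>G K) (a, b) \<le> 2 * domination_degree G a)"
proof -
  have finK: "finite (pverts K)" and cardK: "card (pverts K) = n"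
    and arcsK: "parcs K = {(u, v). u \<in> pverts K \<and> v \<in> pverts K \<and> u \<noteq> v}"
    using assms(4) unfolding complete_digraph_pair_def by auto
  have key: "\<exists>M. minimal_total_dominating_set (G \<circ>\<^sub>G K) M \<and> (a, b) \<in> M \<and> card M \<le> 2 * card S"
    if "b \<in> pverts K" "minimal_dominating_set G S" "a \<in> S" for a b S
  proof -
    \<comment> \<open>A set with at least two elements has one besides \<open>b\<close>; it supplies
      the second layer.\<close>
    obtain b' where "b' \<in> pverts K" "b \<noteq> b'"
      using cardK assms(3) that(1) by (metis card_le_Suc0_iff_eq finK not_less_eq_eq numeral_2_eq_2)
    with minimal_total_dominating_set_composition[OF assms(1) finK arcsK that(1)] that show ?thesis
      by metis
  qed
  have "compliant_vertex (G \<circ>\<^sub>G K) (a, b)" if "a \<in> pverts G" "b \<in> pverts K" for a b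
    using ex_minimal_dominating_set[OF assms(1) that(1)] key[OF that(2)]
    unfolding compliant_vertex_def by metis
  then have "compliant (G \<circ>\<^sub>G K)"
    unfolding compliant_def by (auto simp: composition_def)
  moreover have "total_domination_degree (G \<circ>\<^sub>G K) (a, b) \<le> 2 * domination_degree G a"
    if a: "a \<in> pverts G" and b: "b \<in> pverts K" for a b
  proof -
    \<comment> \<open>Nonemptiness ensures that the infimum is attained by an actual
      \<open>S\<close>, and is not the default 0 of the empty set.\<close>
    have "{card S | S. minimal_dominating_set G S \<and> a \<in> S} \<noteq> {}"
      using ex_minimal_dominating_set[OF assms(1) a] by blast
    from Inf_nat_def1[OF this] obtain S where
      S: "minimal_dominating_set G S" "a \<in> S" "card S = domination_degree G a"
      unfolding domination_degree_def by force
    obtain M where M: "minimal_total_dominating_set (G \<circ>\<^sub>G K) M" "(a, b) \<in> M" "card M \<le> 2 * card S"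
      using key[OF b S(1,2)] by blast
    then have "total_domination_degree (G \<circ>\<^sub>G K) (a, b) \<le> card M"
      unfolding total_domination_degree_def by (intro cInf_lower) auto
    with M(3) S(3) show ?thesis by linarith
  qed
  ultimately show ?thesis by blast
qed

end
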